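(* Let $F$ be a $3$-graph with an even number of vertices such that $V(F)$ can be partitioned into pairs $\{w_i,z_i\}$ such that for each such pair there exist vertices $u,v$ with $\{w_i,u,v\}\in F$ and $\{z_i,u,v\}\in F$. Then for every $\mu > 0$ there exists $n_0$ such that for all $n \ge n_0$ there exists a $3$-graph $H$ on $n$ vertices such that: $|H| = \frac18\binom{n}{3} \pm \mu n^3$; $H$ is $(\frac18,\mu)$-dense; every vertex of $H$ lies in at least $(\frac18-\mu)\binom{n}{2}$ edges; and $H$ has no perfect $F$-packing.
   Context: A $3$-graph $H$ is a set of $3$-element subsets (edges) of a vertex set $V(H)$; $|H|$ is its number of edges. For $X_1,X_2,X_3\subseteq V(H)$, $e(X_1,X_2,X_3)$ is the number of $(x_1,x_2,x_3)\in X_1\times X_2\times X_3$ with $\{x_1,x_2,x_3\}\in H$. An $n$-vertex $3$-graph is $(p,\mu)$-dense if $e(X_1,X_2,X_3)\ge p|X_1||X_2||X_3|-\mu n^3$ for all $X_1,X_2,X_3\subseteq V(H)$. A perfect $F$-packing of $H$ is a partition of $V(H)$ into sets each spanning a copy of $F$. *)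

theory Defs
  imports Complex_Main "HOL-Library.Disjoint_Sets"
begin

record 'a hgraph =
  verts :: "'a set"
  edges :: "'a set set"

definition three_graph :: "'a hgraph \<Rightarrow> bool" where
  "three_graph H \<longleftrightarrow>
     finite (verts H) \<and> (\<forall>e\<in>edges H. e \<subseteq> verts H \<and> card e = 3)"

text \<open>Counts ordered triples; the sets may overlap. Since edges have exactly three elements,
  triples with a repeated entry contribute nothing.\<close>
definition edge_triples :: "'a hgraph \<Rightarrow> 'a set \<Rightarrow> 'a set \<Rightarrow> 'a set \<Rightarrow> nat" where
  "edge_triples H X1 X2 X3 =
     card {(x1, x2, x3). x1 \<in> X1 \<and> x2 \<in> X2 \<and> x3 \<in> X3 \<and> {x1, x2, x3} \<in> edges H}"

definition dense_hgraph :: "real \<Rightarrow> real \<Rightarrow> 'a hgraph \<Rightarrow> bool" where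
  "dense_hgraph p \<mu> H \<longleftrightarrow>
     (\<forall>X1 X2 X3. X1 \<subseteq> verts H \<longrightarrow> X2 \<subseteq> verts H \<longrightarrow> X3 \<subseteq> verts H \<longrightarrow>
        real (edge_triples H X1 X2 X3)
          \<ge> p * real (card X1) * real (card X2) * real (card X3) - \<mu> * real (card (verts H)) ^ 3)"

definition vertex_degree :: "'a hgraph \<Rightarrow> 'a \<Rightarrow> nat" where
  "vertex_degree H v = card {e \<in> edges H. v \<in> e}"

text \<open>The copy need not be induced: the subgraph of \<open>H\<close> induced on \<open>S\<close> may have further edges.\<close>
definition spans_copy :: "'a hgraph \<Rightarrow> 'b hgraph \<Rightarrow> 'a set \<Rightarrow> bool" where
  "spans_copy H F S \<longleftrightarrow>
     (\<exists>f. bij_betw f (verts F) S \<and> (\<forall>e\<in>edges F. f ` e \<in> edges H))"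

definition perfect_packing :: "'a hgraph \<Rightarrow> 'b hgraph \<Rightarrow> 'a set set \<Rightarrow> bool" where
  "perfect_packing H F P \<longleftrightarrow> partition_on (verts H) P \<and> (\<forall>S\<in>P. spans_copy H F S)"

definition has_perfect_packing :: "'a hgraph \<Rightarrow> 'b hgraph \<Rightarrow> bool" where
  "has_perfect_packing H F \<longleftrightarrow> (\<exists>P. perfect_packing H F P)"

end

theory Submission
  imports Defs "HOL-Analysis.Convex"
begin

text \<open>Fix a vertex \<open>0\<close> and a quasirandom graph, given by signs on pairs. Take as edges the triples avoiding
  \<open>0\<close> all of whose pairs are positive, and the triples \<open>{0, u, v}\<close> with \<open>{u, v}\<close> negative and \<open>{0, u}\<close>,
  \<open>{0, v}\<close> positive. No pair lies in both the link of \<open>0\<close> and the link of another vertex, so no copy of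
  \<open>F\<close> covers \<open>0\<close>. The quasirandom graph is a blow-up of a fixed regular symmetric Hadamard matrix, for
  which Lindsey's lemma bounds every correlation term in the edge counts.\<close>

section \<open>The tensor-power Hadamard matrix and its cancellation bounds\<close>

text \<open>The \<open>k\<close>-th tensor power of the \<open>4 \<times> 4\<close> Hadamard matrix \<open>J - 2 I\<close>, indexed by base-4 digits, hence
  \<open>4 ^ k\<close>-periodic in both arguments.\<close>

fun had :: "nat \<Rightarrow> nat \<Rightarrow> nat \<Rightarrow> real" where
  "had 0 x y = 1"
| "had (Suc k) x y = (if x mod 4 = y mod 4 then -1 else 1) * had k (x div 4) (y div 4)"

lemma had_sym: "had k x y = had k y x"
  by (induction k arbitrary: x y) auto

lemma had_sign: "had k x y = 1 \<or> had k x y = -1"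
proof (induction k arbitrary: x y)
  case (Suc k)
  show ?case using Suc[of "x div 4" "y div 4"] by auto
qed auto

lemma sum_lessThan_mult_4:
  fixes F :: "nat \<Rightarrow> 'a::comm_monoid_add"
  shows "(\<Sum>x<4*M. F x) = (\<Sum>j<M. F (4*j) + F (4*j+1) + F (4*j+2) + F (4*j+3))"
proof (induction M)
  case (Suc M)
  have "(\<Sum>x<4 * Suc M. F x) = (\<Sum>x<Suc (Suc (Suc (Suc (4*M)))). F x)"
    by (rule arg_cong[where f = "\<lambda>m. sum F {..<m}"]) simp
  then show ?case using Suc by (simp add: add.assoc numeral_3_eq_3)
qed auto

text \<open>Regularity: a row of \<open>J - 2 I\<close> has three entries 1 and one entry -1, so
  each base-4 digit contributes a factor 2. The induction strips the last digit of \<open>x\<close>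
  by writing \<open>x = 4*j + i\<close>.\<close>

lemma had_row_sum: "(\<Sum>x<4^k*q. had k x y) = 2^k * real q"
proof (induction k arbitrary: y)
  case (Suc k)
  have r: "y mod 4 = 0 \<or> y mod 4 = 1 \<or> y mod 4 = 2 \<or> y mod 4 = 3" by linarith
  have "(\<Sum>x<4^Suc k*q. had (Suc k) x y) = (\<Sum>x<4*(4^k*q). had (Suc k) x y)"
    by (simp add: mult.assoc)
  also have "\<dots> = (\<Sum>j<4^k*q. 2 * had k j (y div 4))"
    unfolding sum_lessThan_mult_4
  proof (rule sum.cong[OF refl])
    fix j :: nat
    have "(4*j+1) mod 4 = 1" "(4*j+2) mod 4 = 2" "(4*j+3) mod 4 = 3"
      "(4*j+1) div 4 = j" "(4*j+2) div 4 = j" "(4*j+3) div 4 = j" by presburger+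
    then show "had (Suc k) (4*j) y + had (Suc k) (4*j+1) y + had (Suc k) (4*j+2) y
        + had (Suc k) (4*j+3) y = 2 * had k j (y div 4)"
      using r by (elim disjE) (simp_all del: One_nat_def)
  qed
  finally show ?case using Suc[of "y div 4"] by (simp flip: sum_distrib_left)
qed auto

text \<open>Digit by digit this is \<open>(J - 2 I)^2 = 4 I\<close>: two equal rows of the small
  matrix have inner product 4, and two different rows disagree in exactly two of the four places,
  giving 0. All digits agree exactly when \<open>y\<close> and \<open>y'\<close> are congruent
  modulo \<open>4^k\<close>.\<close>

lemma had_orthogonal:
  "(\<Sum>x<4^k*q. had k x y * had k x y') = (if y mod 4^k = y' mod 4^k then 4^k * real q else 0)"
proof (induction k arbitrary: y y')
  case (Suc k)
  have r: "y mod 4 = 0 \<or> y mod 4 = 1 \<or> y mod 4 = 2 \<or> y mod 4 = 3" by linarith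
  have r': "y' mod 4 = 0 \<or> y' mod 4 = 1 \<or> y' mod 4 = 2 \<or> y' mod 4 = 3" by linarith
  have "(\<Sum>x<4^Suc k*q. had (Suc k) x y * had (Suc k) x y')
      = (\<Sum>x<4*(4^k*q). had (Suc k) x y * had (Suc k) x y')"
    by (simp add: mult.assoc)
  also have "\<dots> = (\<Sum>j<4^k*q. (if y mod 4 = y' mod 4 then 4 else 0) * (had k j (y div 4) * had k j (y' div 4)))"
    unfolding sum_lessThan_mult_4
  proof (rule sum.cong[OF refl])
    fix j :: nat
    have "(4*j+1) mod 4 = 1" "(4*j+2) mod 4 = 2" "(4*j+3) mod 4 = 3"
      "(4*j+1) div 4 = j" "(4*j+2) div 4 = j" "(4*j+3) div 4 = j" by presburger+
    then show "had (Suc k) (4*j) y * had (Suc k) (4*j) y' + had (Suc k) (4*j+1) y * had (Suc k) (4*j+1) y'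
        + had (Suc k) (4*j+2) y * had (Suc k) (4*j+2) y' + had (Suc k) (4*j+3) y * had (Suc k) (4*j+3) y'
        = (if y mod 4 = y' mod 4 then 4 else 0) * (had k j (y div 4) * had k j (y' div 4))"
      using r r' by (elim disjE) (simp_all del: One_nat_def)
  qed
  also have "\<dots> = (if y mod 4 = y' mod 4 then 4 else 0) *
      (if (y div 4) mod 4^k = (y' div 4) mod 4^k then 4^k * real q else 0)"
    by (simp only: sum_distrib_left[symmetric] Suc)
  also have "\<dots> = (if y mod 4^Suc k = y' mod 4^Suc k then 4^Suc k * real q else 0)"
  proof -
    have "y mod 4^Suc k = y' mod 4^Suc k \<longleftrightarrow>
        y mod 4 = y' mod 4 \<and> (y div 4) mod 4^k = (y' div 4) mod 4^k" (is "?L \<longleftrightarrow> ?R")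
    proof
      assume ?L
      then have e: "4 * (y div 4 mod 4^k) + y mod 4 = 4 * (y' div 4 mod 4^k) + y' mod 4"
        by (simp add: mod_mult2_eq)
      have "r = r' \<and> a = b" if "4 * a + r = 4 * b + r'" "r < 4" "r' < 4" for a b r r' :: nat
        using that by presburger
      from this[OF e] show ?R by simp
    qed (simp add: mod_mult2_eq)
    then show ?thesis by simp
  qed
  finally show ?case .
qed auto

lemma card_residue_class_le:
  fixes N q n c :: nat
  assumes "n \<le> N * q"
  shows "card {y. y < n \<and> y mod N = c} \<le> q"
proof -
  have "inj_on (\<lambda>y. y div N) {y. y < n \<and> y mod N = c}"
    by (rule inj_onI) (metis (mono_tags, lifting) mem_Collect_eq div_mult_mod_eq)
  moreover have "(\<lambda>y. y div N) ` {y. y < n \<and> y mod N = c} \<subseteq> {..<q}"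
    using assms by (auto simp: less_mult_imp_div_less mult.commute)
  ultimately show ?thesis using card_inj_on_le[of _ _ "{..<q}"] by simp
qed

text \<open>Lindsey's lemma for a blow-up: the columns are orthogonal over a full number of periods, and
  completing the outer sum to such a range only adds squares.\<close>

lemma had_bilinear_bound:
  fixes f g :: "nat \<Rightarrow> real"
  assumes n: "4^k \<le> n" and X: "X \<subseteq> {..<n}" and Y: "Y \<subseteq> {..<n}"
    and f: "\<And>x. \<bar>f x\<bar> \<le> 1" and g: "\<And>y. \<bar>g y\<bar> \<le> 1"
  shows "\<bar>\<Sum>x\<in>X. \<Sum>y\<in>Y. f x * g y * had k x y\<bar> \<le> 2 / 2^k * real n ^ 2"
proof -
  \<comment> \<open>The extra period makes \<open>M\<close> at least \<open>n\<close>. Since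
    \<open>4^k\<close> is at most \<open>n\<close>, it costs no more than a factor 2, which is the 2
    in the final bound.\<close>
  define q where "q = n div 4^k + 1"
  define M where "M = 4^k * q"
  have nM: "n \<le> M" unfolding M_def q_def
    by (metis add.commute dividend_less_times_div less_imp_le plus_1_eq_Suc mult_Suc_right mult.commute
        zero_less_power zero_less_numeral)
  have "M = 4^k * (n div 4^k) + 4^k" unfolding M_def q_def by (simp add: algebra_simps)
  moreover have "4^k * (n div 4^k) \<le> n" by simp
  ultimately have M2: "M \<le> 2 * n" using n by linarith
  have fin: "finite X" "finite Y" using X Y finite_subset by blast+
  have cX: "card X \<le> n" "card Y \<le> n" using X Y by (metis card_lessThan card_mono finite_lessThan)+
  define h where "h x = (\<Sum>y\<in>Y. g y * had k x y)" for x
  \<comment> \<open>By orthogonality only those \<open>y'\<close> congruent to \<open>y\<close>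
    survive. There are at most \<open>q\<close> of them, each contributing at most
    \<open>M\<close>.\<close>
  have inner: "\<bar>\<Sum>y'\<in>Y. g y * g y' * (\<Sum>x<M. had k x y * had k x y')\<bar> \<le> real q * real M" for y
  proof -
    have "\<bar>\<Sum>y'\<in>Y. g y * g y' * (\<Sum>x<M. had k x y * had k x y')\<bar>
        \<le> (\<Sum>y'\<in>Y. \<bar>g y * g y' * (\<Sum>x<M. had k x y * had k x y')\<bar>)" by (rule sum_abs)
    also have "\<dots> \<le> (\<Sum>y'\<in>Y. if y' mod 4^k = y mod 4^k then real M else 0)"
    proof (rule sum_mono)
      fix y'
      have "\<bar>g y * g y'\<bar> \<le> 1" using mult_mono[OF f f] g
        by (metis abs_ge_zero abs_mult mult_le_one)
      then have "\<bar>g y * g y'\<bar> * real M \<le> 1 * real M" by (intro mult_right_mono) auto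
      then show "\<bar>g y * g y' * (\<Sum>x<M. had k x y * had k x y')\<bar>
          \<le> (if y' mod 4^k = y mod 4^k then real M else 0)"
        unfolding M_def had_orthogonal by (auto simp: abs_mult)
    qed
    also have "\<dots> = real (card {y' \<in> Y. y' mod 4^k = y mod 4^k}) * real M"
      using fin by (simp add: sum.If_cases Int_def)
    also have "\<dots> \<le> real q * real M"
    proof -
      have "card {y' \<in> Y. y' mod 4^k = y mod 4^k} \<le> card {y'. y' < n \<and> y' mod 4^k = y mod 4^k}"
        using Y by (intro card_mono) auto
      also have "\<dots> \<le> q" using nM unfolding M_def by (rule card_residue_class_le)
      finally show ?thesis by (intro mult_right_mono) auto
    qed
    finally show ?thesis .
  qed
  have "(\<Sum>x\<in>X. (h x)\<^sup>2) \<le> (\<Sum>x<M. (h x)\<^sup>2)"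
    using X nM by (intro sum_mono2) auto
  also have "\<dots> = (\<Sum>x<M. \<Sum>y\<in>Y. \<Sum>y'\<in>Y. g y * g y' * (had k x y * had k x y'))"
    by (simp add: h_def power2_eq_square sum_product mult_ac)
  also have "\<dots> = (\<Sum>y\<in>Y. \<Sum>x<M. \<Sum>y'\<in>Y. g y * g y' * (had k x y * had k x y'))"
    by (rule sum.swap)
  also have "\<dots> = (\<Sum>y\<in>Y. \<Sum>y'\<in>Y. g y * g y' * (\<Sum>x<M. had k x y * had k x y'))"
    unfolding sum_distrib_left by (intro sum.cong refl sum.swap)
  also have "\<dots> \<le> (\<Sum>y\<in>Y. real q * real M)"
    using inner by (intro sum_mono) (meson abs_le_D1)
  also have "\<dots> \<le> real n * (real q * real M)"
    using cX by (simp add: mult_right_mono)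
  finally have hb: "(\<Sum>x\<in>X. (h x)\<^sup>2) \<le> real n * (real q * real M)" .
  have "(\<Sum>x\<in>X. (f x)\<^sup>2) \<le> (\<Sum>x\<in>X. 1)"
    using f by (intro sum_mono) (simp add: abs_square_le_1)
  also have "\<dots> \<le> real n" using cX by simp
  finally have fb: "(\<Sum>x\<in>X. (f x)\<^sup>2) \<le> real n" .
  \<comment> \<open>Cauchy-Schwarz separates the weights \<open>f\<close>, whose squares sum to at
    most \<open>n\<close>, from the weighted row sums \<open>h\<close>.\<close>
  have "(\<Sum>x\<in>X. \<Sum>y\<in>Y. f x * g y * had k x y) = (\<Sum>x\<in>X. f x * h x)"
    by (simp add: h_def sum_distrib_left mult.assoc)
  then have "(\<Sum>x\<in>X. \<Sum>y\<in>Y. f x * g y * had k x y)\<^sup>2 \<le> (\<Sum>x\<in>X. (f x)\<^sup>2) * (\<Sum>x\<in>X. (h x)\<^sup>2)"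
    using Cauchy_Schwarz_ineq_sum[of f h X] by simp
  also have "\<dots> \<le> real n * (real n * (real q * real M))"
    by (intro mult_mono fb hb sum_nonneg) auto
  \<comment> \<open>From \<open>M = 4^k * q\<close> one gets \<open>q * M = (M / 2^k)^2\<close>, so
    the bound is a perfect square.\<close>
  also have "\<dots> = (real n * (real M / 2^k))\<^sup>2"
    by (simp add: M_def power2_eq_square flip: power_mult_distrib)
  finally have "\<bar>\<Sum>x\<in>X. \<Sum>y\<in>Y. f x * g y * had k x y\<bar> \<le> \<bar>real n * (real M / 2^k)\<bar>"
    by (simp only: abs_le_square_iff)
  also have "\<dots> \<le> real n * (real (2 * n) / 2^k)"
    using M2 by (simp add: divide_right_mono mult_left_mono del: of_nat_mult)
  also have "\<dots> = 2 / 2^k * real n ^ 2" by (simp add: power2_eq_square)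
  finally show ?thesis .
qed

text \<open>The \<open>q\<close> complete periods contribute \<open>2^k * q\<close>, at most
  \<open>n / 2^k\<close> because \<open>4^k * q\<close> is at most \<open>n\<close>. The incomplete
  last period has fewer than \<open>4^k\<close> terms, each of absolute value 1.\<close>

lemma had_partial_row_sum:
  "\<bar>\<Sum>x<n. had k v x\<bar> \<le> real n / 2^k + 4^k"
proof -
  define q where "q = n div 4^k"
  have le: "4^k * q \<le> n" unfolding q_def by simp
  have "n mod 4^k < 4^k" by simp
  then have lt: "n < 4^k * q + 4^k" unfolding q_def
    by (metis add_less_cancel_left mult_div_mod_eq)
  have "{..<n} = {..<4^k*q} \<union> {4^k*q..<n}" using le by auto
  then have "(\<Sum>x<n. had k v x) = (\<Sum>x<4^k*q. had k v x) + (\<Sum>x=4^k*q..<n. had k v x)"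
    by (simp add: sum.union_disjoint ivl_disj_int)
  also have "(\<Sum>x<4^k*q. had k v x) = 2^k * real q"
    by (subst had_sym) (rule had_row_sum)
  finally have eq: "(\<Sum>x<n. had k v x) = 2^k * real q + (\<Sum>x=4^k*q..<n. had k v x)" .
  have "\<bar>\<Sum>x=4^k*q..<n. had k v x\<bar> \<le> (\<Sum>x=4^k*q..<n. \<bar>had k v x\<bar>)" by (rule sum_abs)
  also have "\<dots> = real (n - 4^k*q)"
    using had_sign[of k v] by (subst sum.cong[OF refl, of _ _ "\<lambda>_. 1"]) (metis abs_1 abs_minus_cancel, simp)
  also have "\<dots> \<le> real (4^k)" using lt by (subst of_nat_le_iff) linarith
  finally have b: "\<bar>\<Sum>x=4^k*q..<n. had k v x\<bar> \<le> 4^k" by simp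
  have "real (4^k * q) \<le> real n" using le by (subst of_nat_le_iff)
  then have "2^k * (2^k * real q) \<le> real n" by (simp flip: mult.assoc power_mult_distrib)
  then have "2^k * real q \<le> real n / 2^k" by (simp add: field_simps)
  with b eq show ?thesis by (smt (verit) of_nat_0_le_iff zero_le_mult_iff zero_le_power)
qed

section \<open>Sign-defined 3-graphs, and passing from edges to ordered tuples\<close>

text \<open>Vertices carry signs \<open>t\<close> (the two parts) and pairs carry signs \<open>s\<close>; a triple is an edge iff each of its
  vertices has the sign of the opposite pair.\<close>

definition sign_hgraph :: "nat \<Rightarrow> (nat \<Rightarrow> nat \<Rightarrow> real) \<Rightarrow> (nat \<Rightarrow> real) \<Rightarrow> nat hgraph" where
  "sign_hgraph n s t = \<lparr>verts = {..<n}, edges = {e. e \<subseteq> {..<n} \<and> card e = 3 \<and>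
     (\<forall>x\<in>e. \<forall>y\<in>e. \<forall>z\<in>e. x \<noteq> y \<and> x \<noteq> z \<and> y \<noteq> z \<longrightarrow> s y z = t x)}\<rparr>"

lemma verts_sign_hgraph [simp]: "verts (sign_hgraph n s t) = {..<n}"
  by (simp add: sign_hgraph_def)

lemma three_graph_sign_hgraph: "three_graph (sign_hgraph n s t)"
  by (simp add: sign_hgraph_def three_graph_def)

text \<open>Lets distinctness pass between two enumerations of the same set: equal sets have equal
  cardinality.\<close>

lemma card_eq_3_iff_distinct: "card {x, y, z} = 3 \<longleftrightarrow> x \<noteq> y \<and> x \<noteq> z \<and> y \<noteq> z"
  by (auto simp: card_insert_if)

lemma card_ordered_pairs:
  assumes "x \<noteq> y" "x \<noteq> z" "y \<noteq> z"
  shows "card {(b, c). {x, b, c} = {x, y, z}} = 2"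
proof -
  have "{(b, c). {x, b, c} = {x, y, z}} = {(y, z), (z, y)}" (is "?L = ?R")
  proof
    have *: "(b, c) \<in> ?R" if "{x, b, c} = {x, y, z}" for b c
    proof -
      have "x \<noteq> b" "x \<noteq> c" "b \<noteq> c" using assms that card_eq_3_iff_distinct by metis+
      moreover have "b \<in> {x, y, z}" "c \<in> {x, y, z}" using that by blast+
      ultimately show ?thesis by auto
    qed
    show "?L \<subseteq> ?R"
    proof
      fix p assume "p \<in> ?L"
      then show "p \<in> ?R"
        using *[of "fst p" "snd p"] by (simp only: mem_Collect_eq case_prod_unfold prod.collapse)
    qed
  qed auto
  then show ?thesis using assms by simp
qed

lemma card_ordered_triples:
  assumes "x \<noteq> y" "x \<noteq> z" "y \<noteq> z"
  shows "card {(a, b, c). {a, b, c} = {x, y, z}} = 6"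
proof -
  have "{(a, b, c). {a, b, c} = {x, y, z}}
      = {(x, y, z), (x, z, y), (y, x, z), (y, z, x), (z, x, y), (z, y, x)}" (is "?L = ?R")
  proof
    have *: "(a, b, c) \<in> ?R" if e: "{a, b, c} = {x, y, z}" for a b c
    proof -
      have "a \<noteq> b" "a \<noteq> c" "b \<noteq> c" using assms e card_eq_3_iff_distinct by metis+
      moreover have "a \<in> {x, y, z}" "b \<in> {x, y, z}" "c \<in> {x, y, z}" using e by blast+
      ultimately show ?thesis by auto
    qed
    show "?L \<subseteq> ?R"
    proof
      fix p assume "p \<in> ?L"
      then show "p \<in> ?R"
        using *[of "fst p" "fst (snd p)" "snd (snd p)"] by (simp only: mem_Collect_eq case_prod_unfold prod.collapse)
    qed
  qed auto
  then show ?thesis using assms by simp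
qed

text \<open>Double counting: the orderings of different edges are disjoint sets of six triples. The
  edge count thus becomes a special case of the density estimate.\<close>

lemma edge_triples_verts:
  assumes "three_graph H"
  shows "edge_triples H (verts H) (verts H) (verts H) = 6 * card (edges H)"
proof -
  have fin: "finite (verts H)" and E: "\<And>e. e \<in> edges H \<Longrightarrow> e \<subseteq> verts H \<and> card e = 3"
    using assms by (auto simp: three_graph_def)
  have finE: "finite (edges H)"
    by (rule finite_subset[of _ "Pow (verts H)"]) (use fin E in auto)
  let ?T = "\<lambda>e. {(a, b, c). {a, b, c} = e}"
  have six: "card (?T e) = 6" if e: "e \<in> edges H" for e
  proof -
    obtain x y z where "e = {x, y, z}" "x \<noteq> y" "x \<noteq> z" "y \<noteq> z"
      using E[OF e] by (metis card_3_iff)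
    then show ?thesis using card_ordered_triples by metis
  qed
  have "{(x, y, z). x \<in> verts H \<and> y \<in> verts H \<and> z \<in> verts H \<and> {x, y, z} \<in> edges H} = (\<Union>e\<in>edges H. ?T e)"
    using E by auto
  moreover have "card (\<Union>e\<in>edges H. ?T e) = (\<Sum>e\<in>edges H. card (?T e))"
  proof (rule card_UN_disjoint[OF finE])
    \<comment> \<open>An infinite set has \<open>card\<close> 0, so cardinality 6 already forces
      finiteness.\<close>
    show "\<forall>e\<in>edges H. finite (?T e)" using six by (metis card.infinite zero_neq_numeral)
    show "\<forall>e\<in>edges H. \<forall>e'\<in>edges H. e \<noteq> e' \<longrightarrow> ?T e \<inter> ?T e' = {}" by blast
  qed
  ultimately show ?thesis using six by (simp add: edge_triples_def)
qed

lemma card_link_pairs: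
  assumes "three_graph H"
  shows "card {(b, c). b \<in> verts H \<and> c \<in> verts H \<and> {v, b, c} \<in> edges H} = 2 * vertex_degree H v"
proof -
  have fin: "finite (verts H)" and E: "\<And>e. e \<in> edges H \<Longrightarrow> e \<subseteq> verts H \<and> card e = 3"
    using assms by (auto simp: three_graph_def)
  let ?E = "{e \<in> edges H. v \<in> e}"
  have finE: "finite ?E"
    by (rule finite_subset[of _ "Pow (verts H)"]) (use fin E in auto)
  let ?T = "\<lambda>e. {(b, c). {v, b, c} = e}"
  have two: "card (?T e) = 2" if eE: "e \<in> ?E" for e
  proof -
    obtain x y z where e: "e = {x, y, z}" "x \<noteq> y" "x \<noteq> z" "y \<noteq> z"
      using E[of e] eE by (auto simp: card_3_iff)
    moreover have "v = x \<or> v = y \<or> v = z" using e eE by auto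
    moreover have "{x, y, z} = {y, x, z}" "{x, y, z} = {z, x, y}" by auto
    ultimately obtain y' z' where "e = {v, y', z'}" "v \<noteq> y'" "v \<noteq> z'" "y' \<noteq> z'"
      by (elim disjE) blast+
    then show ?thesis using card_ordered_pairs by metis
  qed
  have "{(b, c). b \<in> verts H \<and> c \<in> verts H \<and> {v, b, c} \<in> edges H} = (\<Union>e\<in>?E. ?T e)"
    using E by auto
  moreover have "card (\<Union>e\<in>?E. ?T e) = (\<Sum>e\<in>?E. card (?T e))"
  proof (rule card_UN_disjoint[OF finE])
    show "\<forall>e\<in>?E. finite (?T e)"
    proof
      fix e assume "e \<in> ?E"
      from two[OF this] show "finite (?T e)" by (metis card.infinite zero_neq_numeral)
    qed
    show "\<forall>e\<in>?E. \<forall>e'\<in>?E. e \<noteq> e' \<longrightarrow> ?T e \<inter> ?T e' = {}" by blast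
  qed
  ultimately show ?thesis using two by (simp add: vertex_degree_def)
qed

section \<open>Edge, density and degree estimates for quasirandom signs\<close>

text \<open>Quasirandomness as the estimates need it. \<open>bilinear\<close> is a cut-norm type
  bound; it allows arbitrary bounded weights so that, with one vertex of a triple fixed, all
  remaining signs can be absorbed into \<open>f\<close> and \<open>g\<close>. \<open>row\<close>
  says that every vertex is nearly balanced, which controls the terms of a single link that involve
  only pairs at \<open>v\<close>.\<close>

locale sign_pattern =
  fixes n :: nat and s :: "nat \<Rightarrow> nat \<Rightarrow> real" and t :: "nat \<Rightarrow> real" and \<epsilon> :: real
  assumes sym: "s x y = s y x"
    and s_sign: "s x y = 1 \<or> s x y = -1"
    and t_sign: "t x = 1 \<or> t x = -1"
    and bilinear: "\<lbrakk>X \<subseteq> {..<n}; Y \<subseteq> {..<n}; \<And>x. \<bar>f x\<bar> \<le> 1; \<And>y. \<bar>g y\<bar> \<le> 1\<rbrakk>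
      \<Longrightarrow> \<bar>\<Sum>x\<in>X. \<Sum>y\<in>Y. f x * g y * s x y\<bar> \<le> \<epsilon> * real n ^ 2"
    and row: "\<bar>\<Sum>x<n. s v x\<bar> \<le> \<epsilon> * real n"
begin

abbreviation "H \<equiv> sign_hgraph n s t"

text \<open>The edge indicator as a polynomial in the signs: each factor, halved, tests one sign
  equation, and expansion gives the density 1/8 plus seven sign monomials. Distinctness of the
  vertices is deliberately left out.\<close>

definition I :: "nat \<Rightarrow> nat \<Rightarrow> nat \<Rightarrow> real" where
  "I x y z = (1 + t x * s y z) * (1 + t y * s x z) * (1 + t z * s x y) / 8"

lemma abs_s [simp]: "\<bar>s x y\<bar> = 1" and abs_t [simp]: "\<bar>t x\<bar> = 1"
  using s_sign[of x y] t_sign[of x] by auto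

text \<open>Symmetry of \<open>s\<close> reduces the condition over all ordered choices within an
  edge to one equation per vertex.\<close>

lemma edge_iff:
  "{x, y, z} \<in> edges H \<longleftrightarrow> x < n \<and> y < n \<and> z < n \<and> x \<noteq> y \<and> x \<noteq> z \<and> y \<noteq> z \<and>
     s y z = t x \<and> s x z = t y \<and> s x y = t z"
  unfolding sign_hgraph_def hgraph.select_convs mem_Collect_eq card_eq_3_iff_distinct
  using sym by auto

lemma I_eq: "I x y z = of_bool (s y z = t x \<and> s x z = t y \<and> s x y = t z)"
  using s_sign[of y z] s_sign[of x z] s_sign[of x y] t_sign[of x] t_sign[of y] t_sign[of z]
  unfolding I_def by (elim disjE) simp_all

lemma edge_le_I: "of_bool ({x, y, z} \<in> edges H) \<le> I x y z"
  unfolding I_eq edge_iff by simp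

text \<open>\<open>I\<close> can exceed the true indicator only at triples with a repeated vertex,
  and there one of the subtracted terms is 1.\<close>

lemma I_le_edge:
  "\<lbrakk>x < n; y < n; z < n\<rbrakk> \<Longrightarrow>
    I x y z - of_bool (x = y) - of_bool (x = z) - of_bool (y = z) \<le> of_bool ({x, y, z} \<in> edges H)"
  unfolding I_eq edge_iff by auto

text \<open>For fixed \<open>z\<close> the factors \<open>f x z\<close> and \<open>g y z\<close> are
  bounded weights in \<open>x\<close> and \<open>y\<close>, so \<open>bilinear\<close> applies;
  summing over \<open>z\<close> costs a factor of at most \<open>n\<close>.\<close>

lemma trilinear:
  assumes "X \<subseteq> {..<n}" "Y \<subseteq> {..<n}" "Z \<subseteq> {..<n}"
    and "\<And>x z. \<bar>f x z\<bar> \<le> 1" "\<And>y z. \<bar>g y z\<bar> \<le> 1"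
  shows "\<bar>\<Sum>z\<in>Z. \<Sum>x\<in>X. \<Sum>y\<in>Y. f x z * g y z * s x y\<bar> \<le> \<epsilon> * real n ^ 3"
proof -
  have "\<bar>\<Sum>z\<in>Z. \<Sum>x\<in>X. \<Sum>y\<in>Y. f x z * g y z * s x y\<bar>
      \<le> (\<Sum>z\<in>Z. \<bar>\<Sum>x\<in>X. \<Sum>y\<in>Y. f x z * g y z * s x y\<bar>)" by (rule sum_abs)
  also have "\<dots> \<le> (\<Sum>z\<in>Z. \<epsilon> * real n ^ 2)"
    using assms by (intro sum_mono bilinear) auto
  also have "\<dots> \<le> real n * (\<epsilon> * real n ^ 2)"
  proof -
    have "card Z \<le> n" using assms by (metis card_lessThan card_mono finite_lessThan)
    \<comment> \<open>\<open>bilinear\<close> on empty sets yields nonnegativity of its own bound,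
      which replacing \<open>card Z\<close> by \<open>n\<close> requires.\<close>
    moreover have "0 \<le> \<epsilon> * real n ^ 2"
      using bilinear[of "{}" "{}" "\<lambda>_. 0" "\<lambda>_. 0"] by simp
    ultimately show ?thesis by (simp add: mult_right_mono)
  qed
  finally show ?thesis by (simp add: power2_eq_square power3_eq_cube mult_ac)
qed

text \<open>Other summation orders, for monomials whose distinguished pair is not the two innermost
  variables.\<close>

lemma trilinear':
  assumes "X \<subseteq> {..<n}" "Y \<subseteq> {..<n}" "Z \<subseteq> {..<n}"
    and "\<And>x z. \<bar>f x z\<bar> \<le> 1" "\<And>y z. \<bar>g y z\<bar> \<le> 1"
  shows "\<bar>\<Sum>x\<in>X. \<Sum>y\<in>Y. \<Sum>z\<in>Z. f x z * g y z * s x y\<bar> \<le> \<epsilon> * real n ^ 3"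
    and "\<bar>\<Sum>x\<in>X. \<Sum>z\<in>Z. \<Sum>y\<in>Y. f x z * g y z * s x y\<bar> \<le> \<epsilon> * real n ^ 3"
proof -
  have "(\<Sum>x\<in>X. \<Sum>y\<in>Y. \<Sum>z\<in>Z. f x z * g y z * s x y) = (\<Sum>x\<in>X. \<Sum>z\<in>Z. \<Sum>y\<in>Y. f x z * g y z * s x y)"
    by (intro sum.cong refl sum.swap)
  moreover have "\<dots> = (\<Sum>z\<in>Z. \<Sum>x\<in>X. \<Sum>y\<in>Y. f x z * g y z * s x y)" by (rule sum.swap)
  ultimately show "\<bar>\<Sum>x\<in>X. \<Sum>y\<in>Y. \<Sum>z\<in>Z. f x z * g y z * s x y\<bar> \<le> \<epsilon> * real n ^ 3"
    "\<bar>\<Sum>x\<in>X. \<Sum>z\<in>Z. \<Sum>y\<in>Y. f x z * g y z * s x y\<bar> \<le> \<epsilon> * real n ^ 3"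
    using trilinear[OF assms] by simp_all
qed

text \<open>Each of the seven nonconstant monomials contains a pair sign. Setting that sign aside,
  every other factor involves at most one endpoint of the pair together with the third vertex, so
  \<open>trilinear\<close> bounds the monomial by \<open>\<epsilon> * n^3\<close>.\<close>

lemma sum_I:
  assumes X: "X \<subseteq> {..<n}" and Y: "Y \<subseteq> {..<n}" and Z: "Z \<subseteq> {..<n}"
  shows "\<bar>8 * (\<Sum>x\<in>X. \<Sum>y\<in>Y. \<Sum>z\<in>Z. I x y z) - real (card X) * real (card Y) * real (card Z)\<bar>
    \<le> 7 * \<epsilon> * real n ^ 3"
proof -
  \<comment> \<open>Monomials are arranged as weight, weight, pair sign, with an explicit
    \<open>1\<close> for a trivial weight, to match the form in \<open>trilinear\<close>.\<close>
  have "8 * (\<Sum>x\<in>X. \<Sum>y\<in>Y. \<Sum>z\<in>Z. I x y z) = (\<Sum>x\<in>X. \<Sum>y\<in>Y. \<Sum>z\<in>Z. 1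
      + t x * 1 * s y z + t y * 1 * s x z + (t x * t y) * s x z * s y z
      + t z * 1 * s x y + (t x * t z) * s y z * s x y + (t y * t z) * s x z * s x y
      + (t x * s x z) * (t y * t z * s y z) * s x y)"
    unfolding sum_distrib_left by (intro sum.cong refl) (simp add: I_def field_simps)
  also have "\<dots> = real (card X) * real (card Y) * real (card Z)
      + (\<Sum>x\<in>X. \<Sum>y\<in>Y. \<Sum>z\<in>Z. t x * 1 * s y z) + (\<Sum>x\<in>X. \<Sum>y\<in>Y. \<Sum>z\<in>Z. t y * 1 * s x z)
      + (\<Sum>x\<in>X. \<Sum>y\<in>Y. \<Sum>z\<in>Z. (t x * t y) * s x z * s y z)
      + (\<Sum>x\<in>X. \<Sum>y\<in>Y. \<Sum>z\<in>Z. t z * 1 * s x y)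
      + (\<Sum>x\<in>X. \<Sum>y\<in>Y. \<Sum>z\<in>Z. (t x * t z) * s y z * s x y)
      + (\<Sum>x\<in>X. \<Sum>y\<in>Y. \<Sum>z\<in>Z. (t y * t z) * s x z * s x y)
      + (\<Sum>x\<in>X. \<Sum>y\<in>Y. \<Sum>z\<in>Z. (t x * s x z) * (t y * t z * s y z) * s x y)"
    by (simp only: sum.distrib) simp
  finally have eq: "8 * (\<Sum>x\<in>X. \<Sum>y\<in>Y. \<Sum>z\<in>Z. I x y z) = \<dots>" .
  have 1: "\<bar>\<Sum>x\<in>X. \<Sum>y\<in>Y. \<Sum>z\<in>Z. t x * 1 * s y z\<bar> \<le> \<epsilon> * real n ^ 3"
    by (rule trilinear[OF Y Z X]) auto
  have 2: "\<bar>\<Sum>x\<in>X. \<Sum>y\<in>Y. \<Sum>z\<in>Z. t y * 1 * s x z\<bar> \<le> \<epsilon> * real n ^ 3"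
    by (rule trilinear'(2)[OF X Z Y]) auto
  have 3: "\<bar>\<Sum>x\<in>X. \<Sum>y\<in>Y. \<Sum>z\<in>Z. (t x * t y) * s x z * s y z\<bar> \<le> \<epsilon> * real n ^ 3"
    by (rule trilinear[OF Y Z X]) (auto simp: abs_mult)
  have 4: "\<bar>\<Sum>x\<in>X. \<Sum>y\<in>Y. \<Sum>z\<in>Z. t z * 1 * s x y\<bar> \<le> \<epsilon> * real n ^ 3"
    by (rule trilinear'(1)[OF X Y Z]) auto
  have 5: "\<bar>\<Sum>x\<in>X. \<Sum>y\<in>Y. \<Sum>z\<in>Z. (t x * t z) * s y z * s x y\<bar> \<le> \<epsilon> * real n ^ 3"
    by (rule trilinear'(1)[OF X Y Z]) (auto simp: abs_mult)
  have "(\<Sum>x\<in>X. \<Sum>y\<in>Y. \<Sum>z\<in>Z. (t y * t z) * s x z * s x y)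
      = (\<Sum>x\<in>X. \<Sum>y\<in>Y. \<Sum>z\<in>Z. s x z * (t y * t z) * s x y)" by (simp add: mult_ac)
  then have 6: "\<bar>\<Sum>x\<in>X. \<Sum>y\<in>Y. \<Sum>z\<in>Z. (t y * t z) * s x z * s x y\<bar> \<le> \<epsilon> * real n ^ 3"
    by (simp only:) (rule trilinear'(1)[OF X Y Z], auto simp: abs_mult)
  have 7: "\<bar>\<Sum>x\<in>X. \<Sum>y\<in>Y. \<Sum>z\<in>Z. (t x * s x z) * (t y * t z * s y z) * s x y\<bar> \<le> \<epsilon> * real n ^ 3"
    by (rule trilinear'(1)[OF X Y Z]) (auto simp: abs_mult)
  show ?thesis unfolding eq using 1 2 3 4 5 6 7 by linarith
qed

lemma edge_triples_eq_sum:
  assumes X: "X \<subseteq> {..<n}" and Y: "Y \<subseteq> {..<n}" and Z: "Z \<subseteq> {..<n}"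
  shows "real (edge_triples H X Y Z) = (\<Sum>x\<in>X. \<Sum>y\<in>Y. \<Sum>z\<in>Z. of_bool ({x, y, z} \<in> edges H))"
proof -
  have fin: "finite X" "finite Y" "finite Z" using assms finite_subset by blast+
  have "{(x, y, z). x \<in> X \<and> y \<in> Y \<and> z \<in> Z \<and> {x, y, z} \<in> edges H}
      = (X \<times> Y \<times> Z) \<inter> {(x, y, z). {x, y, z} \<in> edges H}" by auto
  then have "real (edge_triples H X Y Z) = (\<Sum>p\<in>X \<times> Y \<times> Z. of_bool (p \<in> {(x, y, z). {x, y, z} \<in> edges H}))"
    using fin by (simp add: edge_triples_def)
  then show ?thesis by (simp add: sum.cartesian_product case_prod_unfold)
qed

lemma edge_triples_le:
  assumes "X \<subseteq> {..<n}" "Y \<subseteq> {..<n}" "Z \<subseteq> {..<n}"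
  shows "real (edge_triples H X Y Z) \<le> (\<Sum>x\<in>X. \<Sum>y\<in>Y. \<Sum>z\<in>Z. I x y z)"
  unfolding edge_triples_eq_sum[OF assms] by (intro sum_mono edge_le_I)

lemma sum_of_bool_eq_le: "finite A \<Longrightarrow> (\<Sum>y\<in>A. of_bool (x = y) :: real) \<le> 1"
  using card_mono[of "{x}" "A \<inter> {y. x = y}"] by simp

text \<open>Each of the three possible coincidences \<open>x = y\<close>, \<open>x = z\<close>,
  \<open>y = z\<close> accounts for at most \<open>n^2\<close> triples.\<close>

lemma edge_triples_ge:
  assumes X: "X \<subseteq> {..<n}" and Y: "Y \<subseteq> {..<n}" and Z: "Z \<subseteq> {..<n}"
  shows "(\<Sum>x\<in>X. \<Sum>y\<in>Y. \<Sum>z\<in>Z. I x y z) - 3 * real n ^ 2 \<le> real (edge_triples H X Y Z)"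
proof -
  have fin: "finite X" "finite Y" "finite Z" using assms finite_subset by blast+
  have c: "real (card X) \<le> n" "real (card Y) \<le> n" "real (card Z) \<le> n"
    using assms by (metis card_lessThan card_mono finite_lessThan of_nat_le_iff)+
  have "(\<Sum>x\<in>X. \<Sum>y\<in>Y. \<Sum>z\<in>Z. of_bool (x = y) :: real) = (\<Sum>x\<in>X. real (card Z) * (\<Sum>y\<in>Y. of_bool (x = y)))"
    by (simp add: sum_distrib_left)
  also have "\<dots> \<le> (\<Sum>x\<in>X. real n * 1)"
    using fin c by (intro sum_mono mult_mono sum_of_bool_eq_le) (auto intro: sum_nonneg)
  also have "\<dots> \<le> real n * real n" using c by (simp add: mult_right_mono)
  finally have 1: "(\<Sum>x\<in>X. \<Sum>y\<in>Y. \<Sum>z\<in>Z. of_bool (x = y) :: real) \<le> real n * real n" .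
  have "(\<Sum>x\<in>X. \<Sum>y\<in>Y. \<Sum>z\<in>Z. of_bool (x = z) :: real) \<le> (\<Sum>x\<in>X. \<Sum>y\<in>Y. 1)"
    using fin by (intro sum_mono sum_of_bool_eq_le)
  also have "\<dots> \<le> real n * real n" using c by (simp add: mult_mono)
  finally have 2: "(\<Sum>x\<in>X. \<Sum>y\<in>Y. \<Sum>z\<in>Z. of_bool (x = z) :: real) \<le> real n * real n" .
  have "(\<Sum>x\<in>X. \<Sum>y\<in>Y. \<Sum>z\<in>Z. of_bool (y = z) :: real) \<le> (\<Sum>x\<in>X. \<Sum>y\<in>Y. 1)"
    using fin by (intro sum_mono sum_of_bool_eq_le)
  also have "\<dots> \<le> real n * real n" using c by (simp add: mult_mono)
  finally have 3: "(\<Sum>x\<in>X. \<Sum>y\<in>Y. \<Sum>z\<in>Z. of_bool (y = z) :: real) \<le> real n * real n" .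
  have "(\<Sum>x\<in>X. \<Sum>y\<in>Y. \<Sum>z\<in>Z. I x y z - of_bool (x = y) - of_bool (x = z) - of_bool (y = z))
      \<le> real (edge_triples H X Y Z)"
    unfolding edge_triples_eq_sum[OF assms] using assms by (intro sum_mono I_le_edge) auto
  with 1 2 3 show ?thesis by (simp only: sum_subtractf power2_eq_square)
qed

text \<open>With \<open>v\<close> fixed, the four monomials containing \<open>s y z\<close> are
  small by \<open>bilinear\<close>. The two linear ones both sum to the product of the total of
  \<open>t\<close> and a row sum of \<open>s\<close>, so \<open>row\<close> applies; hence the 6.
  The last monomial sums to a square, which is dropped, so the estimate is one-sided.\<close>

lemma sum_link_I:
  "(1 - 6 * \<epsilon>) * real n ^ 2 \<le> 8 * (\<Sum>y<n. \<Sum>z<n. I v y z)"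
proof -
  let ?N = "{..<n}"
  have "8 * (\<Sum>y<n. \<Sum>z<n. I v y z) = (\<Sum>y<n. \<Sum>z<n. 1 + t y * s v z + t z * s v y
      + (t y * s v y) * (t z * s v z)
      + t v * 1 * s y z + t v * t y * (s v z) * s y z + s v y * (t v * t z) * s y z
      + (t v * t y * s v y) * (t z * s v z) * s y z)"
    unfolding sum_distrib_left by (intro sum.cong refl) (simp add: I_def field_simps)
  also have "\<dots> = real n ^ 2 + 2 * ((\<Sum>y<n. t y) * (\<Sum>z<n. s v z)) + (\<Sum>y<n. t y * s v y)\<^sup>2
      + (\<Sum>y<n. \<Sum>z<n. t v * 1 * s y z) + (\<Sum>y<n. \<Sum>z<n. t v * t y * (s v z) * s y z)
      + (\<Sum>y<n. \<Sum>z<n. s v y * (t v * t z) * s y z)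
      + (\<Sum>y<n. \<Sum>z<n. (t v * t y * s v y) * (t z * s v z) * s y z)"
  proof -
    have "(\<Sum>y<n. \<Sum>z<n. t z * s v y) = (\<Sum>y<n. t y) * (\<Sum>z<n. s v z)"
      by (subst sum.swap) (simp add: sum_product)
    then show ?thesis
      by (simp only: sum.distrib) (simp add: sum_product power2_eq_square)
  qed
  finally have eq: "8 * (\<Sum>y<n. \<Sum>z<n. I v y z) = \<dots>" .
  have 1: "\<bar>\<Sum>y<n. \<Sum>z<n. t v * 1 * s y z\<bar> \<le> \<epsilon> * real n ^ 2"
    by (rule bilinear) (auto simp: abs_mult)
  have 2: "\<bar>\<Sum>y<n. \<Sum>z<n. t v * t y * s v z * s y z\<bar> \<le> \<epsilon> * real n ^ 2"
    by (rule bilinear) (auto simp: abs_mult)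
  have 3: "\<bar>\<Sum>y<n. \<Sum>z<n. s v y * (t v * t z) * s y z\<bar> \<le> \<epsilon> * real n ^ 2"
    by (rule bilinear) (auto simp: abs_mult)
  have 4: "\<bar>\<Sum>y<n. \<Sum>z<n. (t v * t y * s v y) * (t z * s v z) * s y z\<bar> \<le> \<epsilon> * real n ^ 2"
    by (rule bilinear) (auto simp: abs_mult)
  have "\<bar>\<Sum>y<n. t y\<bar> \<le> real n" using sum_abs[of t ?N] by simp
  then have "\<bar>(\<Sum>y<n. t y) * (\<Sum>z<n. s v z)\<bar> \<le> real n * (\<epsilon> * real n)"
    unfolding abs_mult using row by (intro mult_mono) auto
  then have 5: "\<bar>(\<Sum>y<n. t y) * (\<Sum>z<n. s v z)\<bar> \<le> \<epsilon> * real n ^ 2"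
    by (simp add: power2_eq_square mult_ac)
  have "0 \<le> (\<Sum>y<n. t y * s v y)\<^sup>2" by simp
  moreover have "(1 - 6 * \<epsilon>) * real n ^ 2 = real n ^ 2 - 6 * (\<epsilon> * real n ^ 2)" by (simp add: algebra_simps)
  ultimately show ?thesis unfolding eq using 1 2 3 4 5 by linarith
qed

text \<open>Ordered pairs count every edge at \<open>v\<close> twice, and the coincidences
  \<open>v = y\<close>, \<open>v = z\<close>, \<open>y = z\<close> cost at most \<open>n\<close>
  pairs each.\<close>

lemma degree_ge:
  assumes v: "v < n"
  shows "(1 - 6 * \<epsilon>) / 8 * real n ^ 2 - 3 * real n \<le> 2 * real (vertex_degree H v)"
proof -
  have "{(b, c). b \<in> verts H \<and> c \<in> verts H \<and> {v, b, c} \<in> edges H}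
      = ({..<n} \<times> {..<n}) \<inter> {(b, c). {v, b, c} \<in> edges H}" by auto
  then have "2 * real (vertex_degree H v)
      = (\<Sum>p\<in>{..<n} \<times> {..<n}. of_bool (p \<in> {(b, c). {v, b, c} \<in> edges H}))"
    using card_link_pairs[OF three_graph_sign_hgraph, of n s t v] by (simp flip: of_nat_mult)
  then have deg: "2 * real (vertex_degree H v) = (\<Sum>y<n. \<Sum>z<n. of_bool ({v, y, z} \<in> edges H))"
    by (simp only: sum.cartesian_product case_prod_unfold mem_Collect_eq)
  have e: "(\<Sum>z<n. of_bool (y = z) :: real) \<le> 1" for y by (rule sum_of_bool_eq_le) simp
  have 1: "(\<Sum>y<n. \<Sum>z<n. of_bool (v = y) :: real) \<le> real n"
    using mult_left_mono[OF e[of v], of "real n"] by (simp flip: sum_distrib_left)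
  have 2: "(\<Sum>y<n. \<Sum>z<n. of_bool (v = z) :: real) \<le> real n"
    using sum_mono[of "{..<n}", OF e[of v]] by simp
  have 3: "(\<Sum>y<n. \<Sum>z<n. of_bool (y = z) :: real) \<le> real n"
    using sum_mono[of "{..<n}", OF e] by simp
  have "(\<Sum>y<n. \<Sum>z<n. I v y z - of_bool (v = y) - of_bool (v = z) - of_bool (y = z))
      \<le> 2 * real (vertex_degree H v)"
    unfolding deg using v by (intro sum_mono I_le_edge) auto
  then have "(\<Sum>y<n. \<Sum>z<n. I v y z) - 3 * real n \<le> 2 * real (vertex_degree H v)"
    using 1 2 3 by (simp only: sum_subtractf)
  then show ?thesis using sum_link_I[of v] by simp
qed

text \<open>The density estimate on the whole vertex set, divided by 6: the error constants come
  from \<open>7/8\<close> and \<open>3\<close>.\<close>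

lemma edges_bounds:
  "\<bar>real (card (edges H)) - real n ^ 3 / 48\<bar> \<le> 7 / 48 * \<epsilon> * real n ^ 3 + real n ^ 2 / 2"
proof -
  have "6 * real (card (edges H)) = real (edge_triples H {..<n} {..<n} {..<n})"
    using edge_triples_verts[OF three_graph_sign_hgraph, of n s t] by simp
  moreover have "0 \<le> real n ^ 2" by simp
  ultimately show ?thesis
    using edge_triples_le[of "{..<n}" "{..<n}" "{..<n}"] edge_triples_ge[of "{..<n}" "{..<n}" "{..<n}"]
      sum_I[of "{..<n}" "{..<n}" "{..<n}"]
    by (simp add: power3_eq_cube abs_le_iff)
qed

lemma dense:
  assumes "7 / 8 * \<epsilon> * real n ^ 3 + 3 * real n ^ 2 \<le> \<mu> * real n ^ 3"
  shows "dense_hgraph (1/8) \<mu> H"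
  unfolding dense_hgraph_def
proof (intro allI impI)
  fix X Y Z assume *: "X \<subseteq> verts H" "Y \<subseteq> verts H" "Z \<subseteq> verts H"
  then show "1/8 * real (card X) * real (card Y) * real (card Z) - \<mu> * real (card (verts H)) ^ 3
      \<le> real (edge_triples H X Y Z)"
    using edge_triples_ge[of X Y Z] sum_I[of X Y Z] assms by (simp add: abs_le_iff)
qed

end

section \<open>The obstruction to a perfect packing\<close>

text \<open>In the copy covering 0, let \<open>{w, z}\<close> be the pair whose image contains 0.
  Both \<open>f w\<close> and \<open>f z\<close> form an edge with \<open>f u\<close> and
  \<open>f v\<close>, so both have the sign \<open>s (f u) (f v)\<close>. But they are distinct, and
  no other vertex has the sign of 0.\<close>

lemma no_perfect_packing_sign_hgraph:
  fixes F :: "'a hgraph"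
  assumes P: "partition_on (verts F) P"
    and pairs: "\<And>p. p \<in> P \<Longrightarrow> \<exists>w z. w \<noteq> z \<and> p = {w, z} \<and>
       (\<exists>u\<in>verts F. \<exists>v\<in>verts F. {w, u, v} \<in> edges F \<and> {z, u, v} \<in> edges F)"
    and sp: "sign_pattern n s t \<epsilon>"
    and t: "\<And>x. x \<noteq> 0 \<Longrightarrow> t x \<noteq> t 0"
    and n: "0 < n"
  shows "\<not> has_perfect_packing (sign_hgraph n s t) F"
proof
  interpret sign_pattern n s t \<epsilon> by (rule sp)
  assume "has_perfect_packing H F"
  then obtain Q where Q: "partition_on {..<n} Q" "\<And>S. S \<in> Q \<Longrightarrow> spans_copy H F S"
    by (auto simp: has_perfect_packing_def perfect_packing_def)
  obtain S where S: "S \<in> Q" "0 \<in> S" using partition_onD1[OF Q(1)] n by blast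
  obtain f where f: "bij_betw f (verts F) S" "\<And>e. e \<in> edges F \<Longrightarrow> f ` e \<in> edges H"
    using Q(2)[OF S(1)] by (auto simp: spans_copy_def)
  obtain a where a: "a \<in> verts F" "f a = 0" using f(1) S(2) by (auto simp: bij_betw_def)
  obtain p where p: "p \<in> P" "a \<in> p" using partition_onD1[OF P] a by blast
  obtain w z u v where wz: "w \<noteq> z" "p = {w, z}" "{w, u, v} \<in> edges F" "{z, u, v} \<in> edges F"
    using pairs[OF p(1)] by blast
  have "w \<in> verts F" "z \<in> verts F" using partition_onD1[OF P] p wz by auto
  then have ne: "f w \<noteq> f z" using wz f(1) by (metis bij_betw_inv_into_left)
  have "{f w, f u, f v} \<in> edges H" "{f z, f u, f v} \<in> edges H" using f(2) wz by force+
  then have "t (f w) = t (f z)" unfolding edge_iff by simp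
  moreover have "f w = 0 \<or> f z = 0" using p wz a by auto
  ultimately show False using ne t by metis
qed

section \<open>Choice of parameters and assembly\<close>

text \<open>\<open>k\<close> depends on \<open>\<epsilon>\<close> alone:
  \<open>2 / 2^k \<le> \<epsilon>\<close> settles \<open>bilinear\<close>. For \<open>row\<close>,
  each of the two terms of \<open>had_partial_row_sum\<close> is at most half of
  \<open>\<epsilon> * n\<close>, the second because \<open>n\<close> is large.\<close>

lemma had_sign_pattern:
  assumes \<epsilon>: "\<epsilon> > 0"
  shows "\<exists>k. \<forall>n t. real n \<ge> 2 * 4^k / \<epsilon> \<longrightarrow> n \<ge> 4^k \<longrightarrow> (\<forall>x. t x = 1 \<or> t x = -1) \<longrightarrow> sign_pattern n (had k) t \<epsilon>"
proof -
  obtain k where "(1/2)^k < \<epsilon> / 2" using real_arch_pow_inv[of "\<epsilon>/2" "1/2"] \<epsilon> by auto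
  then have k: "2 / 2^k \<le> \<epsilon>" by (simp add: power_one_over field_simps)
  have "sign_pattern n (had k) t \<epsilon>" if n: "real n \<ge> 2 * 4^k / \<epsilon>" "n \<ge> 4^k"
    and t: "\<forall>x. t x = 1 \<or> t x = -1" for n t
  proof
    show "had k x y = had k y x" for x y by (rule had_sym)
    show "had k x y = 1 \<or> had k x y = -1" for x y by (rule had_sign)
    show "t x = 1 \<or> t x = -1" for x using t by blast
    show "\<bar>\<Sum>x\<in>X. \<Sum>y\<in>Y. f x * g y * had k x y\<bar> \<le> \<epsilon> * real n ^ 2"
      if "X \<subseteq> {..<n}" "Y \<subseteq> {..<n}" "\<And>x. \<bar>f x\<bar> \<le> 1" "\<And>y. \<bar>g y\<bar> \<le> 1" for X Y f g
      using had_bilinear_bound[where f = f and g = g, OF n(2) that] mult_right_mono[OF k, of "real n ^ 2"] by simp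
    show "\<bar>\<Sum>x<n. had k v x\<bar> \<le> \<epsilon> * real n" for v
    proof -
      have "4^k \<le> \<epsilon> / 2 * real n" using n(1) \<epsilon> by (simp add: field_simps)
      moreover have "real n / 2^k \<le> \<epsilon> / 2 * real n" using mult_right_mono[OF k, of "real n / 2"] by simp
      ultimately show ?thesis using had_partial_row_sum[of k v n] by linarith
    qed
  qed
  then show ?thesis by blast
qed

theorem theorem1p6:
  fixes F :: "'a hgraph"
  assumes "three_graph F"
    and "even (card (verts F))"
    and "\<exists>P. partition_on (verts F) P \<and>
           (\<forall>p\<in>P. \<exists>w z. w \<noteq> z \<and> p = {w, z} \<and>
              (\<exists>u\<in>verts F. \<exists>v\<in>verts F. {w, u, v} \<in> edges F \<and> {z, u, v} \<in> edges F))"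
  shows "\<forall>\<mu>::real. \<mu> > 0 \<longrightarrow> (\<exists>n0::nat. \<forall>n\<ge>n0. \<exists>H :: nat hgraph.
           three_graph H \<and> card (verts H) = n \<and>
           \<bar>real (card (edges H)) - 1/8 * real (n choose 3)\<bar> \<le> \<mu> * real n ^ 3 \<and>
           dense_hgraph (1/8) \<mu> H \<and>
           (\<forall>v\<in>verts H. real (vertex_degree H v) \<ge> (1/8 - \<mu>) * real (n choose 2)) \<and>
           \<not> has_perfect_packing H F)"
proof (intro allI impI)
  fix \<mu> :: real assume \<mu>: "\<mu> > 0"
  obtain P where P: "partition_on (verts F) P" "\<And>p. p \<in> P \<Longrightarrow> \<exists>w z. w \<noteq> z \<and> p = {w, z} \<and>
       (\<exists>u\<in>verts F. \<exists>v\<in>verts F. {w, u, v} \<in> edges F \<and> {z, u, v} \<in> edges F)"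
    using assms(3) by metis
  \<comment> \<open>The leading errors for edge count, density and twice the degree become 7/96,
    7/16 and 3/8 of \<open>\<mu>\<close>, leaving room for lower-order terms.\<close>
  define \<epsilon> where "\<epsilon> = \<mu> / 2"
  have \<epsilon>: "\<epsilon> > 0" using \<mu> by (simp add: \<epsilon>_def)
  obtain k where k: "\<And>n t. \<lbrakk>real n \<ge> 2 * 4^k / \<epsilon>; n \<ge> 4^k; \<forall>x. t x = 1 \<or> t x = -1\<rbrakk> \<Longrightarrow> sign_pattern n (had k) t \<epsilon>"
    using had_sign_pattern[OF \<epsilon>] by metis
  \<comment> \<open>The first summand and \<open>4^k\<close> are the conditions of \<open>k\<close>;
    \<open>8 / \<mu>\<close> and \<open>8\<close> give \<open>8 + 8 * \<mu> \<le> \<mu> * n\<close>,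
    which absorbs every lower-order term.\<close>
  define n0 where "n0 = nat \<lceil>2 * 4^k / \<epsilon> + 8 / \<mu>\<rceil> + 4^k + 8"
  \<comment> \<open>One part is the single vertex 0, as the packing obstruction demands.\<close>
  define t where "t x = (if x = 0 then -1 else 1 :: real)" for x :: nat
  show "\<exists>n0::nat. \<forall>n\<ge>n0. \<exists>H :: nat hgraph.
           three_graph H \<and> card (verts H) = n \<and>
           \<bar>real (card (edges H)) - 1/8 * real (n choose 3)\<bar> \<le> \<mu> * real n ^ 3 \<and>
           dense_hgraph (1/8) \<mu> H \<and>
           (\<forall>v\<in>verts H. real (vertex_degree H v) \<ge> (1/8 - \<mu>) * real (n choose 2)) \<and>
           \<not> has_perfect_packing H F"
  proof (intro exI allI impI conjI)
    fix n assume n0: "n0 \<le> n"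
    have "2 * 4^k / \<epsilon> > 0" "8 / \<mu> > 0" using \<epsilon> \<mu> by simp_all
    moreover have "real n \<ge> 2 * 4^k / \<epsilon> + 8 / \<mu> + 8" using n0 unfolding n0_def by linarith
    ultimately have n: "real n \<ge> 2 * 4^k / \<epsilon>" "real n \<ge> 8 / \<mu> + 8" by linarith+
    have n': "n \<ge> 4^k" "n > 0" using n0 unfolding n0_def by auto
    interpret sign_pattern n "had k" t \<epsilon> using n(1) n'(1) by (rule k) (simp add: t_def)
    have \<mu>n: "8 + 8 * \<mu> \<le> \<mu> * real n" using n(2) \<mu> by (simp add: field_simps)
    have \<mu>n2: "(8 + 8 * \<mu>) * real n \<le> \<mu> * real n ^ 2"
      using mult_right_mono[OF \<mu>n, of "real n"] by (simp add: power2_eq_square mult_ac)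
    have \<mu>n3: "(8 + 8 * \<mu>) * real n ^ 2 \<le> \<mu> * real n ^ 3"
      using mult_right_mono[OF \<mu>n, of "real n ^ 2"] by (simp add: power2_eq_square power3_eq_cube mult_ac)
    have \<mu>sq: "8 * real n ^ 2 \<le> \<mu> * real n ^ 3"
      using \<mu>n3 mult_right_mono[of 8 "8 + 8 * \<mu>" "real n ^ 2"] \<mu> by simp
    show "three_graph H" by (rule three_graph_sign_hgraph)
    show "card (verts H) = n" by simp
    show "dense_hgraph (1/8) \<mu> H"
    proof (rule dense)
      have "7 / 8 * \<epsilon> * real n ^ 3 = 7 / 16 * (\<mu> * real n ^ 3)" by (simp add: \<epsilon>_def)
      moreover have "0 \<le> real n ^ 2" by simp
      ultimately show "7 / 8 * \<epsilon> * real n ^ 3 + 3 * real n ^ 2 \<le> \<mu> * real n ^ 3"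
        using \<mu>sq by linarith
    qed
    show "\<not> has_perfect_packing H F"
      by (rule no_perfect_packing_sign_hgraph[OF P sign_pattern_axioms]) (use n' in \<open>auto simp: t_def\<close>)
    have c3: "real (n choose 3) = real n * (real n - 1) * (real n - 2) / 6"
      by (simp add: binomial_gbinomial gbinomial_prod_rev numeral_3_eq_3 atLeast0_lessThan_Suc mult_ac)
    have c2: "real (n choose 2) = real n * (real n - 1) / 2"
      by (simp add: binomial_gbinomial gbinomial_prod_rev numeral_2_eq_2 atLeast0_lessThan_Suc)
    show "\<bar>real (card (edges H)) - 1/8 * real (n choose 3)\<bar> \<le> \<mu> * real n ^ 3"
    proof -
      have "\<bar>real n ^ 3 / 48 - 1/8 * real (n choose 3)\<bar> \<le> real n ^ 2"
      proof -
        have "real n ^ 3 / 48 - 1/8 * real (n choose 3) = (3 * real n ^ 2 - 2 * real n) / 48"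
          unfolding c3 by (simp add: field_simps power2_eq_square power3_eq_cube)
        moreover have "1 * real n \<le> real n ^ 2" unfolding power2_eq_square using n' by (intro mult_right_mono) auto
        moreover have "0 \<le> real n" by simp
        ultimately show ?thesis by argo
      qed
      moreover have "7 / 48 * \<epsilon> * real n ^ 3 = 7 / 96 * (\<mu> * real n ^ 3)" by (simp add: \<epsilon>_def)
      moreover have "0 \<le> real n ^ 2" by simp
      ultimately show ?thesis using edges_bounds \<mu>sq by argo
    qed
    show "\<forall>v\<in>verts H. (1/8 - \<mu>) * real (n choose 2) \<le> real (vertex_degree H v)"
    proof
      fix v assume v: "v \<in> verts H"
      have "(1/8 - \<mu>) * (real n * (real n - 1)) \<le> (1 - 6 * \<epsilon>) / 8 * real n ^ 2 - 3 * real n"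
      proof -
        have "(1/8 - \<mu>) * (real n * (real n - 1)) = real n ^ 2 / 8 - real n / 8 - \<mu> * real n ^ 2 + \<mu> * real n"
          "(1 - 6 * \<epsilon>) / 8 * real n ^ 2 - 3 * real n = real n ^ 2 / 8 - 3 / 8 * (\<mu> * real n ^ 2) - 3 * real n"
          "(8 + 8 * \<mu>) * real n = 8 * real n + 8 * (\<mu> * real n)"
          by (simp_all add: \<epsilon>_def field_simps power2_eq_square)
        moreover have "0 \<le> \<mu> * real n" "0 \<le> real n" using \<mu> by simp_all
        ultimately show ?thesis using \<mu>n2 by argo
      qed
      then show "(1/8 - \<mu>) * real (n choose 2) \<le> real (vertex_degree H v)"
        using degree_ge[of v] v unfolding c2 by simp
    qed
  qed
qed

end
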